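(* Consider $k$ agents on $SO(3)$ with interaction graph $\mathcal{G}(\mathcal{V},\mathcal{E})$ and fixed reference vectors $y_{ij}=y_{ji}\in S^2$, $(i,j)\in\mathcal{E}$. If the graph analysis algorithm defined in the context reduces $\mathcal{G}(\mathcal{V},\mathcal{E})$ to a single vertex, then $C_o=C_s$ for a generic set of reference vectors $(y_{ij})_{(i,j)\in\mathcal{E}}$.
   Context: $\mathcal{G}(\mathcal{V},\mathcal{E})$ is an undirected finite graph without self-loops, $\mathcal{V}=\{1,\ldots,k\}$. $S^2$ is the unit sphere of $\mathbb{R}^3$. $C_s=\{(Q_1,\ldots,Q_k)\in(SO(3))^k: Q_1=\cdots=Q_k\}$ and $C_o=\{(Q_1,\ldots,Q_k)\in(SO(3))^k: Q_i^Ty_{ij}=Q_j^Ty_{ij}\ \forall(i,j)\in\mathcal{E}\}$. "Generic" means for all choices of $(y_{ij})\in(S^2)^{\#\mathcal{E}}$ outside a set of measure zero. Graph analysis algorithm (operating on the current graph, initially $\mathcal{G}$). As long as there are distinct vertices $i,l,m,p$ with $(i,l),(i,m),(p,l),(p,m),(m,l)$ all edges of the current graph, do: (1) collapse $i,l,m,p$ to a single vertex $i$, which inherits all edges between $\{i,l,m,p\}$ and the rest of the graph (the resulting graph can have several edges connecting two vertices; edges inside the collapsed set disappear); (2) as long as there are vertices $i,j$ connected by more than one edge, collapse $i,j$ into a single vertex $i$ in the same way. When no such $i,l,m,p$ exist, output the resulting graph. *)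

theory Defs
  imports "HOL-Analysis.Analysis" "HOL-Library.Multiset"
begin

section \<open>Graphs and the graph analysis algorithm\<close>

text \<open>Edges of an undirected graph are two-element sets of vertices; in a multigraph they form a
  multiset, so that two vertices can be joined by several edges.\<close>

definition simple_graph :: "'a set \<Rightarrow> 'a set set \<Rightarrow> bool" where
  "simple_graph V E \<longleftrightarrow> finite V \<and> (\<forall>e\<in>E. e \<subseteq> V \<and> card e = 2)"

record 'a mgraph =
  verts :: "'a set"
  edges :: "'a set multiset"

definition mgraph_of :: "'a set \<Rightarrow> 'a set set \<Rightarrow> 'a mgraph" where
  "mgraph_of V E = \<lparr>verts = V, edges = mset_set E\<rparr>"

text \<open>Edges with exactly one end in \<open>U\<close> have that end moved to \<open>i\<close>, with multiplicities added up;
  edges inside \<open>U\<close> are dropped.\<close>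

definition collapse :: "'a set \<Rightarrow> 'a \<Rightarrow> 'a mgraph \<Rightarrow> 'a mgraph" where
  "collapse U i G =
     \<lparr>verts = insert i (verts G - U),
      edges = {# (\<lambda>v. if v \<in> U then i else v) ` e. e \<in># filter_mset (\<lambda>e. \<not> e \<subseteq> U) (edges G) #}\<rparr>"

definition diamond_step :: "'a mgraph \<Rightarrow> 'a mgraph \<Rightarrow> bool" where
  "diamond_step G G' \<longleftrightarrow>
     (\<exists>i l m p. distinct [i, l, m, p] \<and> {i, l, m, p} \<subseteq> verts G \<and>
        {i, l} \<in># edges G \<and> {i, m} \<in># edges G \<and> {p, l} \<in># edges G \<and> {p, m} \<in># edges G \<and>
        {m, l} \<in># edges G \<and>
        G' = collapse {i, l, m, p} i G)"

definition multi_edge_step :: "'a mgraph \<Rightarrow> 'a mgraph \<Rightarrow> bool" where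
  "multi_edge_step G G' \<longleftrightarrow>
     (\<exists>i j. i \<noteq> j \<and> {i, j} \<subseteq> verts G \<and> count (edges G) {i, j} > 1 \<and>
        G' = collapse {i, j} i G)"

text \<open>The loop ``as long as \<open>r\<close> applies, do one round \<open>s\<close>'', as a relation between initial and
  final states.\<close>

definition exhaust :: "('s \<Rightarrow> 's \<Rightarrow> bool) \<Rightarrow> ('s \<Rightarrow> 's \<Rightarrow> bool) \<Rightarrow> 's \<Rightarrow> 's \<Rightarrow> bool" where
  "exhaust r s G H \<longleftrightarrow> s\<^sup>*\<^sup>* G H \<and> (\<nexists>H'. r H H')"

definition analysis_round :: "'a mgraph \<Rightarrow> 'a mgraph \<Rightarrow> bool" where
  "analysis_round = diamond_step OO exhaust multi_edge_step multi_edge_step"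

definition graph_analysis :: "'a mgraph \<Rightarrow> 'a mgraph \<Rightarrow> bool" where
  "graph_analysis = exhaust diamond_step analysis_round"

text \<open>The algorithm does not prescribe which of several collapsible configurations is treated first.
  It is enough that some run ends in a single vertex.\<close>

definition reduces_to_single_vertex :: "'a set \<Rightarrow> 'a set set \<Rightarrow> bool" where
  "reduces_to_single_vertex V E \<longleftrightarrow>
     (\<exists>H. graph_analysis (mgraph_of V E) H \<and> card (verts H) = 1)"

section \<open>Configurations of agents on the rotation group\<close>

definition SO3 :: "(real^3^3) set" where
  "SO3 = {Q. rotation_matrix Q}"

definition C_s :: "'a set \<Rightarrow> ('a \<Rightarrow> real^3^3) set" where
  "C_s V = {Q \<in> V \<rightarrow>\<^sub>E SO3. \<forall>i\<in>V. \<forall>j\<in>V. Q i = Q j}"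

text \<open>Indexing the reference vectors by unordered pairs builds in their symmetry.\<close>

definition C_o :: "'a set \<Rightarrow> 'a set set \<Rightarrow> ('a set \<Rightarrow> real^3) \<Rightarrow> ('a \<Rightarrow> real^3^3) set" where
  "C_o V E y = {Q \<in> V \<rightarrow>\<^sub>E SO3. \<forall>i j. {i, j} \<in> E \<longrightarrow>
     transpose (Q i) *v y {i, j} = transpose (Q j) *v y {i, j}}"

section \<open>Surface measure on the unit sphere\<close>

text \<open>The surface area of \<open>A\<close> is the dimension times the volume of the cone
  \<open>{r x | 0 < r \<le> 1, x \<in> A}\<close>, that is, of the set of points of the punctured unit ball whose
  radial projection lies in \<open>A\<close>.\<close>

definition sphere_measure :: "'a::euclidean_space measure" where
  "sphere_measure = scale_measure (of_nat DIM('a))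
     (distr (restrict_space lborel (cball 0 1 - {0})) (restrict_space borel (sphere 0 1)) sgn)"

lemma space_sphere_measure: "space (sphere_measure :: 'a::euclidean_space measure) = sphere 0 1"
  by (simp add: sphere_measure_def space_scale_measure space_restrict_space)

lemma sets_sphere_measure:
  "sets (sphere_measure :: 'a::euclidean_space measure) = sets (restrict_space borel (sphere 0 1))"
  by (simp add: sphere_measure_def)

lemma measurable_sgn_sphere:
  "sgn \<in> restrict_space lborel (cball 0 1 - {0}) \<rightarrow>\<^sub>M
     restrict_space borel (sphere 0 (1::real) :: 'a::euclidean_space set)"
proof (rule measurable_restrict_space2)
  show "(sgn :: 'a \<Rightarrow> 'a) \<in> space (restrict_space lborel (cball 0 1 - {0})) \<rightarrow> sphere 0 1"
    by (auto simp: space_restrict_space norm_sgn)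
  have "(\<lambda>x::'a. x /\<^sub>R norm x) \<in> borel_measurable lborel" by measurable
  then show "(sgn :: 'a \<Rightarrow> 'a) \<in> restrict_space lborel (cball 0 1 - {0}) \<rightarrow>\<^sub>M borel"
    by (intro measurable_restrict_space1) (simp add: sgn_div_norm[abs_def])
qed

lemma emeasure_sphere_measure:
  fixes A :: "'a::euclidean_space set"
  assumes "A \<in> sets sphere_measure"
  shows "emeasure sphere_measure A =
    of_nat DIM('a) * emeasure lborel {r *\<^sub>R x | r x. 0 < r \<and> r \<le> 1 \<and> x \<in> A}"
proof -
  have A: "A \<in> sets (restrict_space borel (sphere 0 1))" "A \<subseteq> sphere 0 1"
    using assms sets.sets_into_space[OF assms] by (auto simp: sets_sphere_measure space_sphere_measure)
  have eq: "sgn -` A \<inter> (cball 0 1 - {0}) = {r *\<^sub>R x | r x. 0 < r \<and> r \<le> 1 \<and> x \<in> A}"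
  proof (intro set_eqI iffI)
    fix z assume "z \<in> sgn -` A \<inter> (cball 0 1 - {0})"
    then show "z \<in> {r *\<^sub>R x | r x. 0 < r \<and> r \<le> 1 \<and> x \<in> A}"
      by (auto intro!: exI[of _ "norm z"] exI[of _ "sgn z"] simp: sgn_div_norm)
  next
    fix z assume "z \<in> {r *\<^sub>R x | r x. 0 < r \<and> r \<le> 1 \<and> x \<in> A}"
    then obtain r x where z: "z = r *\<^sub>R x" "0 < r" "r \<le> 1" "x \<in> A" by auto
    then have "norm x = 1" using A by auto
    then show "z \<in> sgn -` A \<inter> (cball 0 1 - {0})"
      using z by (auto simp: sgn_div_norm)
  qed
  have sp: "space (restrict_space lborel (cball 0 1 - {0::'a})) = cball 0 1 - {0}"
    by (simp add: space_restrict_space)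
  have sub: "{r *\<^sub>R x | r x. 0 < r \<and> r \<le> 1 \<and> x \<in> A} \<subseteq> cball 0 1 - {0}"
    using eq by blast
  show ?thesis
    unfolding sphere_measure_def
    using A by (simp add: emeasure_distr[OF measurable_sgn_sphere] sp eq
        emeasure_restrict_space[OF _ sub])
qed

lemma emeasure_sphere_measure_S2:
  "emeasure (sphere_measure :: (real^3) measure) (sphere 0 1) = ennreal (4 * pi)"
proof -
  have cone: "{r *\<^sub>R x | r x. 0 < r \<and> r \<le> 1 \<and> x \<in> sphere 0 (1::real)} = cball 0 1 - {0::real^3}"
    (is "?C = _")
  proof (intro set_eqI iffI)
    fix z :: "real^3" assume "z \<in> cball 0 1 - {0}"
    then show "z \<in> ?C"
      by (auto intro!: exI[of _ "norm z"] exI[of _ "sgn z"] simp: sgn_div_norm)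
  qed auto
  have "emeasure (sphere_measure :: (real^3) measure) (sphere 0 1) =
      3 * emeasure lborel (cball 0 1 - {0::real^3})"
    using sets.top[of "sphere_measure :: (real^3) measure"]
    by (subst emeasure_sphere_measure) (simp_all only: cone space_sphere_measure, simp)
  also have "emeasure lborel (cball 0 1 - {0::real^3}) = emeasure lborel (cball 0 1 :: (real^3) set)"
    by (rule emeasure_Diff_null_set) (auto simp: null_sets_def)
  also have "\<dots> = ennreal (4 / 3 * pi)"
    by (simp add: emeasure_cball unit_ball_vol_3)
  also have "3 * \<dots> = ennreal (4 * pi)"
    by (simp flip: ennreal_numeral ennreal_mult)
  finally show ?thesis .
qed

end

theory Submission
  imports Defs
begin

text \<open>
  For an edge \<open>(l, m)\<close> of a configuration in \<open>C_o\<close>, \<open>B = Q\<^sub>m Q\<^sub>l\<^sup>T\<close> is a rotation about \<open>b = y\<^sub>l\<^sub>m\<close>.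
  In a triangle \<open>i, l, m\<close> with \<open>a = y\<^sub>i\<^sub>l\<close> and \<open>c = y\<^sub>i\<^sub>m\<close> one has \<open>B a \<bullet> c = a \<bullet> c\<close>. By Rodrigues'
  formula this is a linear equation for \<open>(cos \<theta> - 1, sin \<theta>)\<close>, where \<open>\<theta>\<close> is the angle of \<open>B\<close>.
  The two triangles of a diamond give two such equations, generically independent, hence \<open>B = 1\<close>
  and then all four rotations agree, since a rotation fixing two independent vectors is trivial;
  the latter fact also covers double edges. So each step of the algorithm collapses only agents that
  are already synchronized, and every edge of a collapsed graph still carries the constraint of its
  own original edge. Each genericity condition says that one reference vector avoids a
  plane determined by the others, so by Fubini it holds almost everywhere.
\<close>

section \<open>Rotations of three-space about an axis\<close>

text \<open>The remainder \<open>d\<close> has zero inner product and zero cross product with the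
  unit vector \<open>cross3 b u\<close>, hence vanishes.\<close>

lemma orthonormal_cross_expansion:
  fixes b u x :: "real^3"
  assumes "norm b = 1" "norm u = 1" "b \<bullet> u = 0"
  shows "x = (x \<bullet> b) *\<^sub>R b + (x \<bullet> u) *\<^sub>R u + (x \<bullet> cross3 b u) *\<^sub>R cross3 b u"
proof -
  let ?n = "cross3 b u"
  define d where "d = x - ((x \<bullet> b) *\<^sub>R b + (x \<bullet> u) *\<^sub>R u + (x \<bullet> ?n) *\<^sub>R ?n)"
  have bb: "b \<bullet> b = 1" "u \<bullet> u = 1" "u \<bullet> b = 0"
    using assms by (auto simp: norm_eq_1 inner_commute)
  have nn: "?n \<bullet> ?n = 1"
    using norm_cross_dot[of b u] assms by (simp add: power2_norm_eq_inner)
  have db: "d \<bullet> b = 0" "d \<bullet> u = 0" "d \<bullet> ?n = 0"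
    by (simp_all add: d_def inner_diff_left inner_add_left bb nn assms dot_cross_self)
  have "cross3 d ?n = (d \<bullet> u) *\<^sub>R b - (d \<bullet> b) *\<^sub>R u"
    by (simp add: Lagrange)
  then have "cross3 d ?n = 0" using db by simp
  then have "d = 0" using norm_and_cross_eq_0[of d ?n] db nn by auto
  then show ?thesis by (simp add: d_def)
qed

lemma rotation_matrix_inner:
  fixes B :: "real^3^3"
  assumes "rotation_matrix B"
  shows "(B *v x) \<bullet> (B *v y) = x \<bullet> y"
proof -
  have "orthogonal_transformation (\<lambda>x. B *v x)"
    using assms by (simp add: orthogonal_transformation_matrix rotation_matrix_def)
  then show ?thesis by (simp add: orthogonal_transformation_def)
qed

text \<open>Rodrigues' formula, with \<open>s = cos \<theta> - 1\<close> and \<open>t = sin \<theta>\<close>.\<close>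

lemma rotation_about_axis:
  fixes B :: "real^3^3"
  assumes B: "rotation_matrix B" and b: "norm b = 1" "B *v b = b"
  obtains s t where
    "\<And>x. B *v x = x + s *\<^sub>R (x - (x \<bullet> b) *\<^sub>R b) + t *\<^sub>R cross3 b x"
proof -
  obtain u' :: "real^3" where u': "u' \<noteq> 0" "b \<bullet> u' = 0"
    using cross_basis_nonzero[of b] b(1) dot_cross_self(1)[of b] by fastforce
  define u where "u = sgn u'"
  have u: "norm u = 1" "b \<bullet> u = 0"
    using u' by (simp_all add: u_def norm_sgn) (simp add: sgn_div_norm)
  let ?n = "cross3 b u"
  note expand = orthonormal_cross_expansion[OF b(1) u]
  have bn: "cross3 b ?n = - u"
    using b u by (simp add: Lagrange norm_eq_1)
  \<comment> \<open>These are the cosine and sine of the rotation angle, read off in the plane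
    orthogonal to \<open>b\<close>.\<close>
  define p where "p = (B *v u) \<bullet> u"
  define q where "q = (B *v u) \<bullet> ?n"
  have "(B *v u) \<bullet> b = 0"
    using rotation_matrix_inner[OF B, of u b] b u by (simp add: inner_commute)
  then have Bu: "B *v u = p *\<^sub>R u + q *\<^sub>R ?n"
    using expand[of "B *v u"] by (simp add: p_def q_def)
  \<comment> \<open>A rotation commutes with the cross product, and \<open>b\<close> is
    fixed.\<close>
  have "B *v ?n = cross3 b (B *v u)"
    using cross_rotation_matrix[OF B, of b u] b by simp
  then have Bn: "B *v ?n = p *\<^sub>R ?n - q *\<^sub>R u"
    by (simp add: Bu cross_add_right cross_mult_right bn)
  show thesis
  proof
    fix x :: "real^3"
    define \<alpha> \<beta> \<gamma> where "\<alpha> = x \<bullet> b" and "\<beta> = x \<bullet> u" and "\<gamma> = x \<bullet> ?n"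
    have x: "x = \<alpha> *\<^sub>R b + \<beta> *\<^sub>R u + \<gamma> *\<^sub>R ?n"
      unfolding \<alpha>_def \<beta>_def \<gamma>_def by (rule expand)
    have "cross3 b x = \<beta> *\<^sub>R ?n - \<gamma> *\<^sub>R u"
      by (subst x) (simp add: cross_add_right cross_mult_right bn)
    moreover have "B *v x = \<alpha> *\<^sub>R b + \<beta> *\<^sub>R (p *\<^sub>R u + q *\<^sub>R ?n) + \<gamma> *\<^sub>R (p *\<^sub>R ?n - q *\<^sub>R u)"
      by (subst x) (simp add: matrix_vector_right_distrib matrix_vector_mult_scaleR Bu Bn b)
    moreover have "x - (x \<bullet> b) *\<^sub>R b = \<beta> *\<^sub>R u + \<gamma> *\<^sub>R ?n"
      using x by (simp add: \<alpha>_def algebra_simps)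
    moreover have "\<alpha> *\<^sub>R b + \<beta> *\<^sub>R (p *\<^sub>R u + q *\<^sub>R ?n) + \<gamma> *\<^sub>R (p *\<^sub>R ?n - q *\<^sub>R u)
        = (\<alpha> *\<^sub>R b + \<beta> *\<^sub>R u + \<gamma> *\<^sub>R ?n)
          + (p - 1) *\<^sub>R (\<beta> *\<^sub>R u + \<gamma> *\<^sub>R ?n) + q *\<^sub>R (\<beta> *\<^sub>R ?n - \<gamma> *\<^sub>R u)"
      by (simp add: algebra_simps)
    ultimately show "B *v x = x + (p - 1) *\<^sub>R (x - (x \<bullet> b) *\<^sub>R b) + q *\<^sub>R cross3 b x"
      by (metis x)
  qed
qed

section \<open>Relative rotations and rigidity of double edges and diamonds\<close>

lemma relative_rotation:
  assumes "Q \<in> SO3" "R \<in> SO3"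
  shows "rotation_matrix (R ** transpose Q)"
  using assms
  by (auto simp: SO3_def rotation_matrix_def det_mul det_transpose orthogonal_matrix_mul
      orthogonal_matrix_transpose)

lemma SO3_transpose_mult:
  assumes "Q \<in> SO3"
  shows "transpose Q ** Q = mat 1" "Q ** transpose Q = mat 1"
  using assms by (auto simp: SO3_def rotation_matrix_def orthogonal_matrix_def)

text \<open>Turns the constraint of an edge into a fixed vector of the relative rotation, so that
  \<open>rotation_about_axis\<close> applies.\<close>

lemma relative_rotation_fixes_iff:
  assumes "Q \<in> SO3" "R \<in> SO3"
  shows "(R ** transpose Q) *v x = x \<longleftrightarrow> transpose Q *v x = transpose R *v x"
proof
  assume "(R ** transpose Q) *v x = x"
  then have "(transpose R ** R) *v (transpose Q *v x) = transpose R *v x"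
    by (metis matrix_vector_mul_assoc matrix_mul_assoc)
  then show "transpose Q *v x = transpose R *v x"
    by (simp only: SO3_transpose_mult(1)[OF assms(2)] matrix_vector_mul_lid)
next
  assume "transpose Q *v x = transpose R *v x"
  then have "(R ** transpose Q) *v x = (R ** transpose R) *v x"
    by (simp only: matrix_vector_mul_assoc[symmetric])
  then show "(R ** transpose Q) *v x = x"
    by (simp only: SO3_transpose_mult(2)[OF assms(2)] matrix_vector_mul_lid)
qed

lemma SO3_eq_if_relative_rotation_id:
  assumes "Q \<in> SO3" "R \<in> SO3" "\<And>x. (R ** transpose Q) *v x = x"
  shows "Q = R"
proof -
  have "R ** transpose Q = mat 1"
    using assms(3) by (simp add: matrix_eq)
  then have "R ** (transpose Q ** Q) = Q" by (simp add: matrix_mul_assoc)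
  then show ?thesis using SO3_transpose_mult(1)[OF assms(1)] by simp
qed

lemma orthogonal_part_nonzero:
  assumes "cross3 b a \<noteq> 0"
  shows "a - c *\<^sub>R b \<noteq> 0"
proof
  assume "a - c *\<^sub>R b = 0"
  then have "a = c *\<^sub>R b" by simp
  then have "cross3 b a = 0" by (metis cross_mult_right cross_refl scaleR_zero_right)
  with assms show False by contradiction
qed

text \<open>In \<open>B a - a\<close> the vectors multiplied by \<open>s\<close> and
  \<open>t\<close> are nonzero and orthogonal to each other, so \<open>B a = a\<close> forces
  \<open>s = t = 0\<close>.\<close>

lemma SO3_eq_if_agree_on_two:
  assumes SO3: "Q \<in> SO3" "R \<in> SO3"
    and b: "norm b = 1" "transpose Q *v b = transpose R *v b"
    and a: "transpose Q *v a = transpose R *v a"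
    and indep: "cross3 a b \<noteq> 0"
  shows "Q = R"
proof -
  define B where "B = R ** transpose Q"
  have fixed: "B *v b = b" "B *v a = a"
    using SO3 a b by (simp_all add: B_def relative_rotation_fixes_iff)
  have rot: "rotation_matrix B" using SO3 by (simp add: B_def relative_rotation)
  obtain s t where B: "\<And>x. B *v x = x + s *\<^sub>R (x - (x \<bullet> b) *\<^sub>R b) + t *\<^sub>R cross3 b x"
    using rotation_about_axis[OF rot b(1) fixed(1)] by blast
  let ?v = "a - (a \<bullet> b) *\<^sub>R b" and ?n = "cross3 b a"
  have n0: "?n \<noteq> 0" using indep cross_skew[of a b] by auto
  have v0: "?v \<noteq> 0" using n0 by (rule orthogonal_part_nonzero)
  have 0: "s *\<^sub>R ?v + t *\<^sub>R ?n = 0" using B[of a] fixed(2) by simp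
  have nv: "?n \<bullet> ?v = 0" by (simp add: inner_diff_right dot_cross_self)
  have "?n \<bullet> (s *\<^sub>R ?v + t *\<^sub>R ?n) = t * (?n \<bullet> ?n)"
    by (simp add: inner_add_right nv)
  then have "t = 0" using 0 n0 by simp
  have "s = 0" using 0 \<open>t = 0\<close> v0 by simp
  show ?thesis
    using SO3_eq_if_relative_rotation_id[OF SO3] B \<open>t = 0\<close> \<open>s = 0\<close> by (simp add: B_def)
qed

text \<open>The coefficients of \<open>cos \<theta> - 1\<close> and \<open>sin \<theta>\<close> in \<open>c \<bullet> (B a - a)\<close>, for the rotation \<open>B\<close> about \<open>b\<close>
  by the angle \<open>\<theta>\<close>.\<close>

definition axial :: "real^3 \<Rightarrow> real^3 \<Rightarrow> real^3 \<Rightarrow> real" where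
  "axial a b c = c \<bullet> (a - (a \<bullet> b) *\<^sub>R b)"

definition triple :: "real^3 \<Rightarrow> real^3 \<Rightarrow> real^3 \<Rightarrow> real" where
  "triple a b c = c \<bullet> cross3 b a"

text \<open>The agent \<open>S\<close> shares \<open>a\<close> with \<open>Q\<close> and
  \<open>c\<close> with \<open>R\<close>, so both vectors can be transported by
  \<open>transpose S\<close>, which preserves inner products.\<close>

lemma triangle_equation:
  assumes SO3: "Q \<in> SO3" "R \<in> SO3" "S \<in> SO3"
    and a: "transpose S *v a = transpose Q *v a"
    and c: "transpose S *v c = transpose R *v c"
    and B: "\<And>x. (R ** transpose Q) *v x = x + s *\<^sub>R (x - (x \<bullet> b) *\<^sub>R b) + t *\<^sub>R cross3 b x"
  shows "s * axial a b c + t * triple a b c = 0"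
proof -
  have "c \<bullet> ((R ** transpose Q) *v a) = (transpose R *v c) \<bullet> (transpose Q *v a)"
    by (simp add: dot_lmul_matrix[symmetric] matrix_vector_mul_assoc[symmetric]
        vector_transpose_matrix)
  also have "\<dots> = (transpose S *v c) \<bullet> (transpose S *v a)" by (simp only: a c)
  also have "\<dots> = c \<bullet> a"
    using SO3(3) rotation_matrix_inner[of "transpose S"]
    by (simp add: SO3_def rotation_matrix_def orthogonal_matrix_transpose det_transpose)
  finally have "c \<bullet> ((R ** transpose Q) *v a) = c \<bullet> a" .
  then show ?thesis unfolding B by (simp add: axial_def triple_def inner_add_right)
qed

lemma diamond_rigid:
  assumes SO3: "Qi \<in> SO3" "Ql \<in> SO3" "Qm \<in> SO3" "Qp \<in> SO3"
    and b: "norm b = 1" "transpose Ql *v b = transpose Qm *v b"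
    and i: "transpose Qi *v a = transpose Ql *v a" "transpose Qi *v c = transpose Qm *v c"
    and p: "transpose Qp *v a' = transpose Ql *v a'" "transpose Qp *v c' = transpose Qm *v c'"
    and norm: "norm c = 1" "norm c' = 1"
    and indep: "cross3 a c \<noteq> 0" "cross3 a' c' \<noteq> 0"
    and generic: "axial a b c * triple a' b c' \<noteq> axial a' b c' * triple a b c"
  shows "Qi = Ql \<and> Qm = Ql \<and> Qp = Ql"
proof -
  have "(Qm ** transpose Ql) *v b = b"
    using SO3 b(2) by (simp add: relative_rotation_fixes_iff)
  then obtain s t where B: "\<And>x. (Qm ** transpose Ql) *v x
      = x + s *\<^sub>R (x - (x \<bullet> b) *\<^sub>R b) + t *\<^sub>R cross3 b x"
    using rotation_about_axis[OF relative_rotation b(1)] SO3 by metis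
  have 1: "s * axial a b c + t * triple a b c = 0"
    by (rule triangle_equation[OF SO3(2,3,1) i B])
  have 2: "s * axial a' b c' + t * triple a' b c' = 0"
    by (rule triangle_equation[OF SO3(2,3,4) p B])
  \<comment> \<open>Cramer's rule: the bracket is the determinant of the two equations.\<close>
  have "s * (axial a b c * triple a' b c' - axial a' b c' * triple a b c) = 0"
    using 1 2 by algebra
  moreover have "t * (axial a b c * triple a' b c' - axial a' b c' * triple a b c) = 0"
    using 1 2 by algebra
  ultimately have "s = 0" "t = 0" using generic by auto
  then have ml: "Ql = Qm"
    using SO3_eq_if_relative_rotation_id[of Ql Qm] SO3 B by simp
  moreover have "Qi = Ql"
    using SO3_eq_if_agree_on_two[of Qi Ql c a] SO3 i norm indep ml by metis
  moreover have "Qp = Ql"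
    using SO3_eq_if_agree_on_two[of Qp Ql c' a'] SO3 p norm indep ml by metis
  ultimately show ?thesis by simp
qed

section \<open>Null sets of reference vectors\<close>

text \<open>The cone over this great subsphere lies in a hyperplane through the origin, which is
  Lebesgue null.\<close>

lemma null_sphere_hyperplane:
  fixes w :: "'a::euclidean_space"
  assumes "w \<noteq> 0"
  shows "{x \<in> sphere 0 1. x \<bullet> w = 0} \<in> null_sets sphere_measure"
proof -
  let ?A = "{x \<in> sphere 0 1. x \<bullet> w = 0}" and ?H = "{x. w \<bullet> x = 0}"
  have "closed ?H" by (rule closed_hyperplane)
  have "?A = sphere 0 1 \<inter> ?H" by (auto simp: inner_commute)
  then have A: "?A \<in> sets sphere_measure"
    unfolding sets_sphere_measure sets_restrict_space
    using \<open>closed ?H\<close> by (intro image_eqI[of _ _ ?H]) auto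
  have H: "?H \<in> null_sets lborel"
    using negligible_hyperplane[of w 0] assms \<open>closed ?H\<close>
    by (simp add: negligible_iff_null_sets null_sets_completion_iff)
  have "{r *\<^sub>R x | r x. 0 < r \<and> r \<le> 1 \<and> x \<in> ?A} \<subseteq> ?H"
    by (auto simp: inner_commute)
  then have "emeasure lborel {r *\<^sub>R x | r x. 0 < r \<and> r \<le> 1 \<and> x \<in> ?A} \<le> emeasure lborel ?H"
    using H by (intro emeasure_mono) auto
  then have "emeasure lborel {r *\<^sub>R x | r x. 0 < r \<and> r \<le> 1 \<and> x \<in> ?A} = 0"
    using H by (simp add: null_sets_def)
  then show ?thesis
    using A by (intro null_setsI) (simp_all only: emeasure_sphere_measure[OF A] mult_zero_right)
qed

text \<open>Fubini, with coordinate \<open>i\<close> as the inner integral. Stating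
  \<open>fibre\<close> by updates of full points spares its users the splitting of the index
  set.\<close>

lemma (in product_sigma_finite) AE_PiM_if_AE_fibre:
  assumes fin: "finite I" and i: "i \<in> I"
    and sets: "{x \<in> space (PiM I M). \<not> P x} \<in> sets (PiM I M)"
    and fibre: "\<And>x. x \<in> space (PiM I M) \<Longrightarrow> AE z in M i. P (x(i := z))"
  shows "AE x in PiM I M. P x"
proof (cases "space (M i) = {}")
  case True
  then have "space (PiM I M) = {}"
    using i by (auto simp: space_PiM PiE_eq_empty_iff)
  then show ?thesis by (intro AE_I2) (simp only: empty_iff)
next
  case False
  define J where "J = I - {i}"
  have I: "insert i J = I" and J: "finite J" "i \<notin> J"
    using i fin by (auto simp: J_def)
  let ?N = "{x \<in> space (PiM I M). \<not> P x}"
  have "emeasure (PiM I M) ?N = (\<integral>\<^sup>+ x. indicator ?N x \<partial>PiM (insert i J) M)"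
    using sets by (simp add: I)
  also have "\<dots> = (\<integral>\<^sup>+ x. (\<integral>\<^sup>+ z. indicator ?N (x(i := z)) \<partial>M i) \<partial>PiM J M)"
    using sets by (intro product_nn_integral_insert J) (simp add: I)
  also have "\<dots> = (\<integral>\<^sup>+ x. 0 \<partial>PiM J M)"
  proof (rule nn_integral_cong)
    fix x assume x: "x \<in> space (PiM J M)"
    \<comment> \<open>\<open>fibre\<close> expects a full point, so \<open>x\<close> is completed by
      an arbitrary \<open>z0\<close>, which the update then overwrites.\<close>
    obtain z0 where "z0 \<in> space (M i)" using False by auto
    then have "x(i := z0) \<in> space (PiM I M)"
      using x unfolding I[symmetric] by (auto simp: space_PiM PiE_fun_upd)
    from fibre[OF this] have "AE z in M i. P (x(i := z))" by simp
    then have "AE z in M i. indicator ?N (x(i := z)) = (0::ennreal)"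
      by eventually_elim (simp add: indicator_def)
    then have "(\<integral>\<^sup>+ z. indicator ?N (x(i := z)) \<partial>M i) = (\<integral>\<^sup>+ z. 0 \<partial>M i)"
      by (rule nn_integral_cong_AE)
    then show "(\<integral>\<^sup>+ z. indicator ?N (x(i := z)) \<partial>M i) = 0"
      by (simp only: nn_integral_const mult_zero_left)
  qed
  finally have "?N \<in> null_sets (PiM I M)" using sets by (simp add: null_sets_def)
  then show ?thesis by (rule AE_I') auto
qed

lemma borel_measurable_cross3 [measurable (raw)]:
  assumes "f \<in> borel_measurable M" "g \<in> borel_measurable M"
  shows "(\<lambda>x. cross3 (f x) (g x)) \<in> borel_measurable M"
  by (rule borel_measurable_continuous_Pair[OF assms])
    (intro continuous_on_cross continuous_intros)

lemma sigma_finite_sphere_measure: "sigma_finite_measure (sphere_measure :: (real^3) measure)"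
proof -
  have "finite_measure (sphere_measure :: (real^3) measure)"
    by (rule finite_measureI) (simp add: space_sphere_measure emeasure_sphere_measure_S2)
  then show ?thesis by (rule finite_measure.axioms)
qed

lemma borel_measurable_ref:
  assumes "e \<in> E"
  shows "(\<lambda>y. y e) \<in> borel_measurable (PiM E (\<lambda>_. sphere_measure :: (real^3) measure))"
proof -
  have "(\<lambda>x. x) \<in> borel_measurable (sphere_measure :: (real^3) measure)"
    using measurable_ident[of borel] measurable_restrict_space1
    by (metis (no_types, lifting) eq_id_iff id_apply measurable_cong_sets sets_sphere_measure)
  from measurable_compose[OF measurable_component_singleton[OF assms] this] show ?thesis .
qed

text \<open>Along a fibre in direction \<open>e\<close> the vector \<open>w y\<close> is constant,
  so \<open>y e\<close> only has to miss a great circle. Later uses establish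
  \<open>w y \<noteq> 0\<close> from other generic conditions.\<close>

lemma AE_not_orthogonal:
  fixes w :: "('e \<Rightarrow> real^3) \<Rightarrow> real^3"
  assumes E: "finite E" "e \<in> E"
    and w [measurable]: "w \<in> borel_measurable (PiM E (\<lambda>_. sphere_measure))"
    and indep: "\<And>y z. w (y(e := z)) = w y"
  shows "AE y in PiM E (\<lambda>_. sphere_measure). w y \<noteq> 0 \<longrightarrow> y e \<bullet> w y \<noteq> 0"
proof -
  interpret product_sigma_finite "\<lambda>_::'e. sphere_measure :: (real^3) measure"
    using sigma_finite_sphere_measure by (simp add: product_sigma_finite_def)
  note [measurable] = borel_measurable_ref[OF E(2)]
  show ?thesis
  proof (rule AE_PiM_if_AE_fibre[OF E])
    show "{y \<in> space (PiM E (\<lambda>_. sphere_measure)). \<not> (w y \<noteq> 0 \<longrightarrow> y e \<bullet> w y \<noteq> 0)}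
        \<in> sets (PiM E (\<lambda>_. sphere_measure))"
      by measurable
    fix y :: "'e \<Rightarrow> real^3"
    show "AE z in sphere_measure. w (y(e := z)) \<noteq> 0 \<longrightarrow> (y(e := z)) e \<bullet> w (y(e := z)) \<noteq> 0"
    proof (cases "w y = 0")
      case False
      then show ?thesis
        by (intro AE_I'[OF null_sphere_hyperplane]) (auto simp: indep space_sphere_measure)
    qed (simp add: indep)
  qed
qed

section \<open>Genericity conditions\<close>

text \<open>The last condition is the determinant condition of \<open>diamond_rigid\<close>. It
  ranges over all distinct edges, since a diamond of a collapsed graph may come from edges that form
  no diamond in \<open>E\<close>.\<close>

definition generic_refs :: "'e set \<Rightarrow> ('e \<Rightarrow> real^3) \<Rightarrow> bool" where
  "generic_refs E y \<longleftrightarrow>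
     (\<forall>e\<in>E. norm (y e) = 1) \<and>
     (\<forall>e\<in>E. \<forall>f\<in>E. e \<noteq> f \<longrightarrow> cross3 (y e) (y f) \<noteq> 0) \<and>
     (\<forall>a\<in>E. \<forall>b\<in>E. \<forall>c\<in>E. \<forall>a'\<in>E. \<forall>c'\<in>E. distinct [a, b, c, a', c'] \<longrightarrow>
        axial (y a) (y b) (y c) * triple (y a') (y b) (y c') \<noteq>
        axial (y a') (y b) (y c') * triple (y a) (y b) (y c))"

text \<open>A nonzero \<open>y f\<close> has a nonzero cross product with some coordinate axis, and
  generically \<open>y e\<close> is not orthogonal to that product.\<close>

lemma AE_cross3_nonzero:
  assumes "finite E" "e \<in> E" "f \<in> E" "e \<noteq> f"
  shows "AE y in PiM E (\<lambda>_. sphere_measure). cross3 (y e) (y f) \<noteq> 0"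
proof -
  note [measurable] = borel_measurable_ref[OF assms(3)]
  have axes: "AE y in PiM E (\<lambda>_. sphere_measure).
      cross3 (y f) u \<noteq> 0 \<longrightarrow> y e \<bullet> cross3 (y f) u \<noteq> 0" for u
    by (rule AE_not_orthogonal) (use assms in auto)
  have "AE y in PiM E (\<lambda>_. sphere_measure). norm (y f) = 1"
    using assms(3) by (intro AE_I2) (auto simp: space_PiM space_sphere_measure)
  with axes[of "axis 1 1"] axes[of "axis 2 1"] axes[of "axis 3 1"] show ?thesis
  proof eventually_elim
    case (elim y)
    have "y f \<noteq> 0" using elim(4) by auto
    then obtain u where "y e \<bullet> cross3 (y f) u \<noteq> 0"
      using cross_basis_nonzero[of "y f"] elim by blast
    moreover have "y e \<bullet> cross3 (y f) u = cross3 (y e) (y f) \<bullet> u"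
      by (simp add: cross3_simps)
    ultimately show ?case by auto
  qed
qed

lemma AE_diamond_generic:
  assumes "finite E" and E: "a \<in> E" "b \<in> E" "c \<in> E" "a' \<in> E" "c' \<in> E"
    and dist: "distinct [a, b, c, a', c']"
  shows "AE y in PiM E (\<lambda>_. sphere_measure).
    axial (y a) (y b) (y c) * triple (y a') (y b) (y c') \<noteq>
    axial (y a') (y b) (y c') * triple (y a) (y b) (y c)"
proof -
  note [measurable] = E[THEN borel_measurable_ref]
  \<comment> \<open>The difference of the two sides is linear in \<open>y c\<close>;
    \<open>w y\<close> is the vector representing it.\<close>
  define w :: "_ \<Rightarrow> real^3" where "w y =
    triple (y a') (y b) (y c') *\<^sub>R (y a - (y a \<bullet> y b) *\<^sub>R y b) -
    axial (y a') (y b) (y c') *\<^sub>R cross3 (y b) (y a)" for y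
  have "AE y in PiM E (\<lambda>_. sphere_measure). w y \<noteq> 0 \<longrightarrow> y c \<bullet> w y \<noteq> 0"
  proof (rule AE_not_orthogonal)
    show "w \<in> borel_measurable (PiM E (\<lambda>_. sphere_measure))"
      unfolding w_def triple_def axial_def by measurable
  qed (use assms in \<open>auto simp: w_def\<close>)
  moreover have "AE y in PiM E (\<lambda>_. sphere_measure).
      cross3 (y b) (y a') \<noteq> 0 \<longrightarrow> y c' \<bullet> cross3 (y b) (y a') \<noteq> 0"
    by (rule AE_not_orthogonal) (use assms in auto)
  moreover have "AE y in PiM E (\<lambda>_. sphere_measure). cross3 (y b) (y a') \<noteq> 0"
    by (rule AE_cross3_nonzero) (use assms in auto)
  moreover have "AE y in PiM E (\<lambda>_. sphere_measure). cross3 (y b) (y a) \<noteq> 0"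
    by (rule AE_cross3_nonzero) (use assms in auto)
  ultimately show ?thesis
  proof eventually_elim
    case (elim y)
    let ?v = "y a - (y a \<bullet> y b) *\<^sub>R y b"
    have "?v \<noteq> 0" using elim(4) by (rule orthogonal_part_nonzero)
    moreover have "triple (y a') (y b) (y c') \<noteq> 0" using elim by (simp add: triple_def)
    \<comment> \<open>Pairing with \<open>?v\<close> removes the cross product term, so
      \<open>w y \<noteq> 0\<close> follows from the nonzero triple product.\<close>
    moreover have "?v \<bullet> w y = triple (y a') (y b) (y c') * (?v \<bullet> ?v)"
      unfolding w_def by (simp add: inner_diff_right inner_diff_left dot_cross_self)
    ultimately have "w y \<noteq> 0" by auto
    then have "y c \<bullet> w y \<noteq> 0" using elim by simp
    then show ?case
      by (simp add: w_def axial_def[of "y a"] triple_def[of "y a"] inner_diff_right[of "y c" "_ *\<^sub>R _"] mult.commute)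
  qed
qed

lemma AE_generic_refs:
  assumes "finite E"
  shows "AE y in PiM E (\<lambda>_. sphere_measure). generic_refs E y"
proof -
  have *: "AE y in PiM E (\<lambda>_. sphere_measure). norm (y e) = 1" if "e \<in> E" for e
    using that by (intro AE_I2) (auto simp: space_PiM space_sphere_measure)
  show ?thesis
    unfolding generic_refs_def
    by (intro AE_conjI AE_finite_allI[OF assms] * AE_impI AE_cross3_nonzero AE_diamond_generic assms)
qed

section \<open>Synchronized quotients along a run of the algorithm\<close>

text \<open>\<open>G\<close> arises from \<open>(V, E)\<close> by merging vertices along \<open>\<phi>\<close>, and merged agents have equal states.
  Since \<open>\<subseteq>#\<close> respects multiplicities, parallel edges of \<open>G\<close> have distinct origins in \<open>E\<close>.\<close>

definition sync_quotient ::
    "'a set \<Rightarrow> 'a set set \<Rightarrow> ('a \<Rightarrow> 'q) \<Rightarrow> ('a \<Rightarrow> 'a) \<Rightarrow> 'a mgraph \<Rightarrow> bool" where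
  "sync_quotient V E Q \<phi> G \<longleftrightarrow> verts G \<subseteq> V \<and> \<phi> ` V \<subseteq> verts G \<and> (\<forall>v\<in>V. Q (\<phi> v) = Q v) \<and>
     edges G \<subseteq># image_mset ((`) \<phi>) (mset_set E)"

lemma sync_quotient_mgraph_of: "sync_quotient V E Q id (mgraph_of V E)"
  by (simp add: sync_quotient_def mgraph_of_def)

text \<open>Composing \<open>\<phi>\<close> with the map that sends \<open>U\<close> to
  \<open>i\<close> works. Edges inside \<open>U\<close> are dropped, so the edges are only included
  in the image multiset.\<close>

lemma sync_quotient_collapse:
  assumes G: "sync_quotient V E Q \<phi> G" and U: "U \<subseteq> verts G" "i \<in> U"
    and Q: "\<And>u. u \<in> U \<Longrightarrow> Q u = Q i"
  shows "\<exists>\<psi>. sync_quotient V E Q \<psi> (collapse U i G)"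
proof
  let ?r = "\<lambda>v. if v \<in> U then i else v"
  have "edges (collapse U i G) \<subseteq># image_mset ((`) ?r) (edges G)"
    unfolding collapse_def by (simp add: image_mset_subseteq_mono)
  also have "\<dots> \<subseteq># image_mset ((`) ?r) (image_mset ((`) \<phi>) (mset_set E))"
    using G by (intro image_mset_subseteq_mono) (simp add: sync_quotient_def)
  finally have "edges (collapse U i G) \<subseteq># image_mset ((`) (?r \<circ> \<phi>)) (mset_set E)"
    by (simp only: multiset.map_comp image_comp[symmetric] comp_def image_image)
  moreover have "Q ((?r \<circ> \<phi>) v) = Q v" if "v \<in> V" for v
    using that G Q[of "\<phi> v"] by (simp add: sync_quotient_def)
  moreover have "verts (collapse U i G) \<subseteq> V" "(?r \<circ> \<phi>) ` V \<subseteq> verts (collapse U i G)"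
    using G U by (auto simp: sync_quotient_def collapse_def)
  ultimately show "sync_quotient V E Q (?r \<circ> \<phi>) (collapse U i G)"
    by (simp add: sync_quotient_def)
qed

lemma sync_quotient_edge:
  assumes V: "simple_graph V E" and Q: "Q \<in> C_o V E y" and G: "sync_quotient V E Q \<phi> G"
    and f: "f \<in> E" "\<phi> ` f = {i, j}" "i \<noteq> j"
  shows "transpose (Q i) *v y f = transpose (Q j) *v y f"
proof -
  obtain a b where ab: "a \<in> f" "\<phi> a = i" "b \<in> f" "\<phi> b = j"
    using f(2) by (metis imageE insertI1 insert_commute)
  have "card f = 2" "f \<subseteq> V" using V f by (auto simp: simple_graph_def)
  moreover have "a \<noteq> b" using ab f by auto
  ultimately have "f = {a, b}" using ab by (auto simp: card_2_iff)
  moreover have "Q i = Q a" "Q j = Q b"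
    using G ab \<open>f \<subseteq> V\<close> by (auto simp: sync_quotient_def)
  ultimately show ?thesis using Q f(1) by (auto simp: C_o_def)
qed

lemma sync_quotient_edge_origin:
  assumes "finite E" "sync_quotient V E Q \<phi> G" "e \<in># edges G"
  obtains f where "f \<in> E" "\<phi> ` f = e"
proof -
  have "e \<in># image_mset ((`) \<phi>) (mset_set E)"
    using assms by (auto simp: sync_quotient_def dest: mset_subset_eqD)
  then show thesis using that assms(1) by auto
qed

lemma simple_graph_finite_edges: "simple_graph V E \<Longrightarrow> finite E"
  by (auto simp: simple_graph_def intro: finite_subset[of E "Pow V"])

lemma C_o_SO3: "Q \<in> C_o V E y \<Longrightarrow> v \<in> V \<Longrightarrow> Q v \<in> SO3"
  by (auto simp: C_o_def)

lemma sync_quotient_multi_edge_step: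
  assumes V: "simple_graph V E" and Q: "Q \<in> C_o V E y" and y: "generic_refs E y"
    and G: "sync_quotient V E Q \<phi> G" and step: "multi_edge_step G G'"
  shows "\<exists>\<psi>. sync_quotient V E Q \<psi> G'"
proof -
  obtain i j where ij: "i \<noteq> j" "{i, j} \<subseteq> verts G" "count (edges G) {i, j} > 1"
      "G' = collapse {i, j} i G"
    using step unfolding multi_edge_step_def by blast
  have fin: "finite E" using V by (rule simple_graph_finite_edges)
  let ?F = "{f \<in> E. \<phi> ` f = {i, j}}"
  have "count (edges G) {i, j} \<le> count (image_mset ((`) \<phi>) (mset_set E)) {i, j}"
    using G by (simp add: sync_quotient_def mset_subset_eq_count)
  \<comment> \<open>A multiplicity in the image multiset counts the origins in \<open>E\<close>, so
    a double edge has two distinct origins.\<close>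
  also have "\<dots> = card ?F"
    using fin by (simp add: count_image_mset vimage_def Int_def conj_commute)
  finally have "\<not> card ?F \<le> Suc 0" using ij(3) by simp
  then obtain f g where fg: "f \<in> E" "\<phi> ` f = {i, j}" "g \<in> E" "\<phi> ` g = {i, j}" "f \<noteq> g"
    using fin by (subst (asm) card_le_Suc0_iff_eq) auto
  have "verts G \<subseteq> V" using G by (simp add: sync_quotient_def)
  then have "Q i \<in> SO3" "Q j \<in> SO3" using C_o_SO3[OF Q] ij(2) by auto
  then have "Q i = Q j"
    by (rule SO3_eq_if_agree_on_two[of _ _ "y g" "y f"])
      (use y fg ij(1) sync_quotient_edge[OF V Q G] in \<open>auto simp: generic_refs_def\<close>)
  then show ?thesis unfolding ij(4) using ij(2) by (intro sync_quotient_collapse[OF G]) auto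
qed

lemma sync_quotient_diamond_step:
  assumes V: "simple_graph V E" and Q: "Q \<in> C_o V E y" and y: "generic_refs E y"
    and G: "sync_quotient V E Q \<phi> G" and step: "diamond_step G G'"
  shows "\<exists>\<psi>. sync_quotient V E Q \<psi> G'"
proof -
  obtain i l m p where dist: "distinct [i, l, m, p]" and sub: "{i, l, m, p} \<subseteq> verts G"
    and e: "{i, l} \<in># edges G" "{i, m} \<in># edges G" "{p, l} \<in># edges G" "{p, m} \<in># edges G"
      "{m, l} \<in># edges G"
    and G': "G' = collapse {i, l, m, p} i G"
    using step unfolding diamond_step_def by blast
  have fin: "finite E" using V by (rule simple_graph_finite_edges)
  note origin = sync_quotient_edge_origin[OF fin G]
  obtain a where a: "a \<in> E" "\<phi> ` a = {i, l}" using origin e(1) .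
  obtain c where c: "c \<in> E" "\<phi> ` c = {i, m}" using origin e(2) .
  obtain a' where a': "a' \<in> E" "\<phi> ` a' = {p, l}" using origin e(3) .
  obtain c' where c': "c' \<in> E" "\<phi> ` c' = {p, m}" using origin e(4) .
  obtain b where b: "b \<in> E" "\<phi> ` b = {l, m}" using origin e(5) by (metis insert_commute)
  \<comment> \<open>The images under \<open>\<phi>\<close> are five different pairs, hence so are
    the origins.\<close>
  have distinct: "distinct [a, b, c, a', c']"
    using a b c a' c' dist by (auto simp: doubleton_eq_iff)
  have "verts G \<subseteq> V" using G by (simp add: sync_quotient_def)
  then have SO3: "Q i \<in> SO3" "Q l \<in> SO3" "Q m \<in> SO3" "Q p \<in> SO3"
    using C_o_SO3[OF Q] sub by auto
  note edge = sync_quotient_edge[OF V Q G]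
  have "Q i = Q l \<and> Q m = Q l \<and> Q p = Q l"
  proof (rule diamond_rigid[OF SO3])
    show "axial (y a) (y b) (y c) * triple (y a') (y b) (y c') \<noteq>
        axial (y a') (y b) (y c') * triple (y a) (y b) (y c)"
      using y a b c a' c' distinct by (simp add: generic_refs_def)
    show "cross3 (y a) (y c) \<noteq> 0" "cross3 (y a') (y c') \<noteq> 0"
      "norm (y b) = 1" "norm (y c) = 1" "norm (y c') = 1"
      using y a b c a' c' distinct by (auto simp: generic_refs_def)
  qed (use edge a b c a' c' dist in auto)
  then show ?thesis unfolding G' using sub by (intro sync_quotient_collapse[OF G]) auto
qed

text \<open>The existence of \<open>\<phi>\<close> is an invariant of both the inner and the outer
  loop.\<close>

lemma sync_quotient_analysis:
  assumes "simple_graph V E" "Q \<in> C_o V E y" "generic_refs E y"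
    and run: "graph_analysis (mgraph_of V E) H"
  shows "\<exists>\<phi>. sync_quotient V E Q \<phi> H"
proof -
  let ?I = "\<lambda>G. \<exists>\<phi>. sync_quotient V E Q \<phi> G"
  have multi: "?I H" if "multi_edge_step\<^sup>*\<^sup>* G H" "?I G" for G H
    using that by induction (use sync_quotient_multi_edge_step[OF assms(1-3)] in blast)+
  have round: "?I H" if rnd: "analysis_round G H" and G: "?I G" for G H
  proof -
    obtain G' where "diamond_step G G'" and G': "multi_edge_step\<^sup>*\<^sup>* G' H"
      using rnd unfolding analysis_round_def exhaust_def by blast
    then have "?I G'"
      using G sync_quotient_diamond_step[OF assms(1-3)] by blast
    with G' show ?thesis by (rule multi)
  qed
  have "analysis_round\<^sup>*\<^sup>* (mgraph_of V E) H"
    using run by (simp add: graph_analysis_def exhaust_def)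
  then show ?thesis
    by induction (use sync_quotient_mgraph_of round in blast)+
qed

section \<open>Generic equality of \<open>C_o\<close> and \<open>C_s\<close>\<close>

lemma C_s_subset_C_o:
  assumes "simple_graph V E"
  shows "C_s V \<subseteq> C_o V E y"
proof
  fix Q assume Q: "Q \<in> C_s V"
  have "Q i = Q j" if "{i, j} \<in> E" for i j
    using that assms Q by (fastforce simp: simple_graph_def C_s_def)
  then show "Q \<in> C_o V E y" using Q by (auto simp: C_s_def C_o_def)
qed

theorem corollary1:
  fixes k :: nat and E :: "nat set set"
  assumes "simple_graph {1..k} E"
    and "reduces_to_single_vertex {1..k} E"
  shows "AE y in PiM E (\<lambda>_. sphere_measure :: (real^3) measure). C_o {1..k} E y = C_s {1..k}"
proof -
  obtain H where H: "graph_analysis (mgraph_of {1..k} E) H" "card (verts H) = 1"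
    using assms(2) unfolding reduces_to_single_vertex_def by blast
  have "AE y in PiM E (\<lambda>_. sphere_measure :: (real^3) measure). generic_refs E y"
    using assms(1) by (intro AE_generic_refs simple_graph_finite_edges)
  then show ?thesis
  proof eventually_elim
    case (elim y)
    have "C_o {1..k} E y \<subseteq> C_s {1..k}"
    proof
      fix Q assume Q: "Q \<in> C_o {1..k} E y"
      obtain \<phi> where \<phi>: "sync_quotient {1..k} E Q \<phi> H"
        using sync_quotient_analysis[OF assms(1) Q elim H(1)] by blast
      obtain r where "verts H = {r}" using H(2) by (auto simp: card_1_singleton_iff)
      \<comment> \<open>Here \<open>\<phi>\<close> sends every vertex to \<open>r\<close>, and
        \<open>Q\<close> is unchanged by \<open>\<phi>\<close>.\<close>
      then have "Q v = Q r" if "v \<in> {1..k}" for v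
        using that \<phi> unfolding sync_quotient_def by (metis imageI singletonD subsetD)
      then show "Q \<in> C_s {1..k}" using Q by (auto simp: C_s_def C_o_def)
    qed
    with C_s_subset_C_o[OF assms(1)] show ?case by blast
  qed
qed

end
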